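(* Let $K$ be an algebraic number field with a power integral basis, and let $O_K$ be its ring of algebraic integers. Let $m$ be a positive integer and let $\alpha_1,\ldots,\alpha_k\in O_K$ and nonzero $\beta_1,\ldots,\beta_k\in O_K$ be such that the system $\{\alpha_s+\beta_sO_K\}_{s=1}^k$ forms an $m$-cover of $O_K$. Let $\omega_1,\ldots,\omega_k\in O_K$. Then for any $\mu\in K$, the set $$\Big\{I\subseteq\{1,\ldots,k\}:\ \sum_{s\in I}\frac{\omega_s}{\beta_s}\in\mu+O_K\Big\}$$ is either empty or has at least $2^m$ elements.
   Context: For $\alpha,\beta\in O_K$, $\alpha+\beta O_K=\{\alpha+\beta\omega:\ \omega\in O_K\}$. The system $\{\alpha_s+\beta_sO_K\}_{s=1}^k$ is an $m$-cover of $O_K$ if $|\{1\le s\le k:\ x\in\alpha_s+\beta_sO_K\}|\ge m$ for all $x\in O_K$. A number field $K$ of degree $n$ has a power integral basis if there is $\gamma\in O_K$ such that $1,\gamma,\ldots,\gamma^{n-1}$ is a $\mathbb{Z}$-basis of $O_K$. *)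

theory Defs
  imports Complex_Main "HOL-Computational_Algebra.Polynomial"
begin

global_interpretation rat_vs: vector_space "\<lambda>(q::rat) (x::'a::field_char_0). of_rat q * x"
  by unfold_locales (simp_all add: algebra_simps of_rat_add of_rat_mult)

global_interpretation int_mod: module "\<lambda>(c::int) (x::'a::field_char_0). of_int c * x"
  by unfold_locales (simp_all add: algebra_simps)

text \<open>
  A number field is a subset of an arbitrary ambient field of characteristic zero. The ambient
  field may be \<open>K\<close> itself (\<open>K = UNIV\<close>), so nothing is lost compared with abstract fields.
\<close>

definition subfield_set :: "'a::field set \<Rightarrow> bool" where
  "subfield_set K \<longleftrightarrow> 0 \<in> K \<and> 1 \<in> K \<and>
     (\<forall>x\<in>K. \<forall>y\<in>K. x + y \<in> K \<and> x * y \<in> K) \<and> (\<forall>x\<in>K. - x \<in> K \<and> inverse x \<in> K)"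

definition number_field :: "'a::field_char_0 set \<Rightarrow> bool" where
  "number_field K \<longleftrightarrow> subfield_set K \<and> (\<exists>B. finite B \<and> rat_vs.span B = K)"

definition field_degree :: "'a::field_char_0 set \<Rightarrow> nat" where
  "field_degree K = rat_vs.dim K"

definition ring_of_integers :: "'a::field_char_0 set \<Rightarrow> 'a set" where
  "ring_of_integers K = {x \<in> K. algebraic_int x}"

text \<open>
  The powers form a basis as a family indexed by \<open>i < n\<close>; as the library's
  independence is a property of sets, distinctness of the powers is stated separately.
\<close>

definition has_power_integral_basis :: "'a::field_char_0 set \<Rightarrow> bool" where
  "has_power_integral_basis K \<longleftrightarrow>
     (\<exists>\<gamma>\<in>ring_of_integers K.
        inj_on (\<lambda>i. \<gamma> ^ i) {..<field_degree K} \<and>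
        int_mod.independent ((\<lambda>i. \<gamma> ^ i) ` {..<field_degree K}) \<and>
        int_mod.span ((\<lambda>i. \<gamma> ^ i) ` {..<field_degree K}) = ring_of_integers K)"

definition residue_coset :: "'a::field_char_0 set \<Rightarrow> 'a \<Rightarrow> 'a \<Rightarrow> 'a set" where
  "residue_coset K \<alpha> \<beta> = (\<lambda>\<omega>. \<alpha> + \<beta> * \<omega>) ` ring_of_integers K"

definition is_m_cover ::
  "'a::field_char_0 set \<Rightarrow> nat \<Rightarrow> nat \<Rightarrow> (nat \<Rightarrow> 'a) \<Rightarrow> (nat \<Rightarrow> 'a) \<Rightarrow> bool" where
  "is_m_cover K m k \<alpha> \<beta> \<longleftrightarrow>
     (\<forall>x\<in>ring_of_integers K. m \<le> card {s \<in> {1..k}. x \<in> residue_coset K (\<alpha> s) (\<beta> s)})"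

end

(* Let O be the ring of integers of K and gamma the generator of the power basis. The coefficient of
   gamma^(n-1) is a functional l on K under which O is its own dual: if l(x theta) is an integer for
   all x in O, then theta is in O. So psi = exp(2 pi i l) is a character of K, trivial on O, and the
   characters x |-> psi(x theta) of O separate the classes of K modulo O.

   For x in O, the factor 1 - psi((x - alpha_s) omega_s / beta_s) vanishes as soon as x lies in the
   s-th coset. Expand the product of these factors over all s outside a set U of fewer than m indices,
   times the leading terms for s in U; it vanishes for every x, and by independence of characters so
   does the part of the sum belonging to the class of mu. Thus a function on subsets of {1..k},
   nonzero exactly on the sets I to be counted, is orthogonal to all monomials of degree below m on
   the cube, and such a function, if nonzero, has at least 2^m points in its support (the minimum
   distance of Reed-Muller codes). *)

theory Submission
  imports Defs "HOL-Library.Real_Mod" "Jordan_Normal_Form.Char_Poly"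
begin

section \<open>Linear independence of characters\<close>

text \<open>Artin's elimination argument, arranged to isolate a single character
  \<open>\<phi>\<close>: the indices in \<open>E\<close> all carry \<open>\<phi>\<close>, those in
  \<open>D\<close> carry characters different from it, which may coincide with each other. Removing
  an element of \<open>D\<close> only rescales the sum over \<open>E\<close> by a nonzero factor;
  once \<open>D\<close> is empty, evaluation at 0 finishes.\<close>

lemma sum_coeffs_same_character_eq_0:
  fixes \<chi> :: "'i \<Rightarrow> 'g::monoid_add \<Rightarrow> 'f::field"
  assumes "finite D" "finite E"
    and "0 \<in> G" and "\<And>x y. x \<in> G \<Longrightarrow> y \<in> G \<Longrightarrow> x + y \<in> G"
    and "\<And>i x y. i \<in> E \<union> D \<Longrightarrow> x \<in> G \<Longrightarrow> y \<in> G \<Longrightarrow> \<chi> i (x + y) = \<chi> i x * \<chi> i y"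
    and "\<phi> 0 = 1"
    and "\<And>i x. i \<in> E \<Longrightarrow> x \<in> G \<Longrightarrow> \<chi> i x = \<phi> x"
    and "\<And>i. i \<in> D \<Longrightarrow> \<exists>x\<in>G. \<chi> i x \<noteq> \<phi> x"
    and "E \<inter> D = {}"
    and "\<And>x. x \<in> G \<Longrightarrow> (\<Sum>i\<in>E \<union> D. a i * \<chi> i x) = 0"
  shows "sum a E = 0"
  using assms
proof (induction D arbitrary: a rule: finite_induct)
  case empty
  from empty.prems(9)[OF empty.prems(2)] empty.prems(2,5,6) show ?case by simp
next
  case (insert d D)
  obtain y where y: "y \<in> G" "\<chi> d y \<noteq> \<phi> y" using insert.prems(7)[of d] by auto
  \<comment> \<open>Shifting by \<open>y\<close> and subtracting \<open>\<chi> d y\<close> times the relation eliminates \<open>d\<close>.\<close>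
  define b where "b i = a i * (\<chi> i y - \<chi> d y)" for i
  have "sum b E = 0"
  proof (rule insert.IH)
    fix x assume x: "x \<in> G"
    have *: "E \<union> insert d D = insert d (E \<union> D)" "d \<notin> E \<union> D"
      using insert.prems(8) insert.hyps by auto
    \<comment> \<open>Since \<open>b d = 0\<close>, the term of \<open>d\<close> can be put back,
      which makes the given relation applicable.\<close>
    have "(\<Sum>i\<in>E \<union> D. b i * \<chi> i x) = (\<Sum>i\<in>E \<union> insert d D. b i * \<chi> i x)"
      using * insert.hyps(1) insert.prems(1) by (simp add: b_def)
    also have "\<dots> = (\<Sum>i\<in>E \<union> insert d D. a i * \<chi> i (x + y)) - \<chi> d y * (\<Sum>i\<in>E \<union> insert d D. a i * \<chi> i x)"
      unfolding sum_distrib_left sum_subtractf[symmetric]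
      by (intro sum.cong refl) (simp add: b_def insert.prems(4) x y algebra_simps)
    also have "\<dots> = 0" using insert.prems(9) insert.prems(3)[OF x y(1)] x by simp
    finally show "(\<Sum>i\<in>E \<union> D. b i * \<chi> i x) = 0" .
  qed (use insert.prems in auto)
  moreover have "sum b E = (\<phi> y - \<chi> d y) * sum a E"
    unfolding sum_distrib_left by (intro sum.cong refl) (simp add: b_def insert.prems(6) y)
  ultimately show ?case using y by simp
qed

section \<open>Supports of functions on the cube of subsets\<close>

lemma sum_Pow_insert:
  fixes F :: "'b set \<Rightarrow> 'f::comm_monoid_add"
  assumes "finite S" "s \<notin> S"
  shows "(\<Sum>I\<in>{I. I \<subseteq> insert s S \<and> P I}. F I)
    = (\<Sum>I\<in>{I. I \<subseteq> S \<and> P I}. F I) + (\<Sum>I\<in>{I. I \<subseteq> S \<and> P (insert s I)}. F (insert s I))"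
proof -
  have inj: "inj_on (insert s) {I. I \<subseteq> S \<and> P (insert s I)}"
    using assms(2) by (intro inj_onI) (metis (mono_tags, lifting) insert_ident mem_Collect_eq subsetD)
  have "{I. I \<subseteq> insert s S \<and> P I} = {I. I \<subseteq> S \<and> P I} \<union> insert s ` {I. I \<subseteq> S \<and> P (insert s I)}"
    (is "_ = ?A \<union> ?B")
  proof (intro equalityI subsetI)
    fix I assume I: "I \<in> {I. I \<subseteq> insert s S \<and> P I}"
    show "I \<in> ?A \<union> ?B"
    proof (cases "s \<in> I")
      case True
      hence "insert s (I - {s}) = I" by auto
      moreover have "I - {s} \<subseteq> S" using I by auto
      ultimately show ?thesis using I by (intro UnI2 image_eqI[of _ _ "I - {s}"]) auto
    qed (use I in auto)
  qed auto
  moreover have "finite ?A" "finite ?B" using assms(1) by auto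
  moreover have "?A \<inter> ?B = {}" using assms(2) by auto
  ultimately show ?thesis by (simp add: sum.union_disjoint sum.reindex[OF inj])
qed

text \<open>Induction on the dimension of the cube. Of the two halves, \<open>F\<close> lives on the
  sets without \<open>s\<close> and \<open>F'\<close> on those with \<open>s\<close>. If one half
  vanishes, the other inherits the hypothesis with the same \<open>m\<close>. If neither does, each
  satisfies it with \<open>m - 1\<close>, and the two supports add up to twice the smaller
  bound.\<close>

lemma card_support:
  fixes F :: "'b set \<Rightarrow> 'f::ab_group_add"
  assumes "finite S"
    and "\<And>U. U \<subseteq> S \<Longrightarrow> card U < m \<Longrightarrow> (\<Sum>I | I \<subseteq> S \<and> U \<subseteq> I. F I) = 0"
    and "I\<^sub>0 \<subseteq> S" "F I\<^sub>0 \<noteq> 0"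
  shows "2 ^ m \<le> card {I. I \<subseteq> S \<and> F I \<noteq> 0}"
  using assms
proof (induction S arbitrary: m F I\<^sub>0 rule: finite_induct)
  case empty
  have "m = 0"
  proof (rule ccontr)
    assume "m \<noteq> 0"
    then show False using empty.prems(1)[of "{}"] empty.prems(2,3) by simp
  qed
  moreover have "{I. I \<subseteq> {} \<and> F I \<noteq> 0} = {{}}" using empty.prems by auto
  ultimately show ?case by simp
next
  case (insert s S)
  define F' where "F' I = F (insert s I)" for I
  let ?N = "\<lambda>F. card {I. I \<subseteq> S \<and> F I \<noteq> 0}"
  \<comment> \<open>Summing the constant 1 turns the splitting of sums into a splitting of
    cardinalities.\<close>
  have split: "card {I. I \<subseteq> insert s S \<and> F I \<noteq> 0} = ?N F + ?N F'"
    using sum_Pow_insert[OF insert.hyps, where F = "\<lambda>_. 1::nat" and P = "\<lambda>I. F I \<noteq> 0"] by (simp add: F'_def)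
  \<comment> \<open>Testing against \<open>insert s U\<close> sees only the half \<open>F'\<close>,
    at the cost of one degree; testing against \<open>U\<close> itself, as in \<open>sum0\<close>,
    sees the sum of both halves.\<close>
  have sum': "(\<Sum>I | I \<subseteq> S \<and> U \<subseteq> I. F' I) = 0" if "U \<subseteq> S" "Suc (card U) < m" for U
  proof -
    have "s \<notin> U" and fin: "finite U" using that insert.hyps by (auto intro: finite_subset)
    then have "(\<Sum>I | I \<subseteq> insert s S \<and> insert s U \<subseteq> I. F I) = 0"
      using that by (intro insert.prems(1)) auto
    moreover have "{I. I \<subseteq> S \<and> insert s U \<subseteq> I} = {}" using insert.hyps by auto
    moreover have "{I. I \<subseteq> S \<and> insert s U \<subseteq> insert s I} = {I. I \<subseteq> S \<and> U \<subseteq> I}"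
      using \<open>s \<notin> U\<close> by auto
    ultimately show ?thesis by (simp only: sum_Pow_insert[OF insert.hyps]) (simp add: F'_def)
  qed
  have sum0: "(\<Sum>I | I \<subseteq> S \<and> U \<subseteq> I. F I) + (\<Sum>I | I \<subseteq> S \<and> U \<subseteq> I. F' I) = 0"
    if "U \<subseteq> S" "card U < m" for U
  proof -
    have "(\<Sum>I | I \<subseteq> insert s S \<and> U \<subseteq> I. F I) = 0"
      using that by (intro insert.prems(1)) auto
    moreover have "{I. I \<subseteq> S \<and> U \<subseteq> insert s I} = {I. I \<subseteq> S \<and> U \<subseteq> I}"
      using that insert.hyps by auto
    ultimately show ?thesis by (simp only: sum_Pow_insert[OF insert.hyps]) (simp add: F'_def)
  qed
  consider "\<forall>I\<subseteq>S. F I = 0" | "\<forall>I\<subseteq>S. F' I = 0" | J J' where "J \<subseteq> S" "F J \<noteq> 0" "J' \<subseteq> S" "F' J' \<noteq> 0"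
    by blast
  then show ?case
  proof cases
    case 1
    have "s \<in> I\<^sub>0" using 1 insert.prems by auto
    then have ne: "F' (I\<^sub>0 - {s}) \<noteq> 0" using insert.prems by (simp add: F'_def insert_absorb)
    have "2 ^ m \<le> ?N F'"
    proof (rule insert.IH[of m F', OF _ _ ne])
      show "I\<^sub>0 - {s} \<subseteq> S" using insert.prems by auto
      show "(\<Sum>I | I \<subseteq> S \<and> U \<subseteq> I. F' I) = 0" if "U \<subseteq> S" "card U < m" for U
        using sum0[OF that] 1 by simp
    qed
    then show ?thesis using split by simp
  next
    case 2
    have "s \<notin> I\<^sub>0"
    proof
      assume "s \<in> I\<^sub>0"
      then have "F' (I\<^sub>0 - {s}) \<noteq> 0" using insert.prems by (simp add: F'_def insert_absorb)
      moreover have "I\<^sub>0 - {s} \<subseteq> S" using insert.prems by auto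
      ultimately show False using 2 by blast
    qed
    have "2 ^ m \<le> ?N F"
    proof (rule insert.IH[of m F, OF _ _ insert.prems(3)])
      show "I\<^sub>0 \<subseteq> S" using insert.prems \<open>s \<notin> I\<^sub>0\<close> by auto
      show "(\<Sum>I | I \<subseteq> S \<and> U \<subseteq> I. F I) = 0" if "U \<subseteq> S" "card U < m" for U
        using sum0[OF that] 2 by simp
    qed
    then show ?thesis using split by simp
  next
    case 3
    show ?thesis
    proof (cases m)
      case 0
      have "finite {I. I \<subseteq> S \<and> F I \<noteq> 0}" using insert.hyps by auto
      then have "?N F \<noteq> 0" using 3 by auto
      then show ?thesis using split 0 by simp
    next
      case (Suc l)
      have "2 ^ l \<le> ?N F"
      proof (rule insert.IH[of l F, OF _ 3(1,2)])
        show "(\<Sum>I | I \<subseteq> S \<and> U \<subseteq> I. F I) = 0" if "U \<subseteq> S" "card U < l" for U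
          using sum0[of U] sum'[of U] that Suc by simp
      qed
      moreover have "2 ^ l \<le> ?N F'"
        by (rule insert.IH[of l F', OF _ 3(3,4)]) (use sum' Suc in simp)
      ultimately show ?thesis using split Suc by simp
    qed
  qed
qed

section \<open>Integer polynomials in an algebraic integer\<close>

text \<open>The value is an eigenvalue of an integer matrix, hence a root of its characteristic
  polynomial, which is monic with integer coefficients. With a power basis this makes the ring of
  integers closed under multiplication.\<close>

lemma algebraic_int_of_int_poly:
  fixes x :: "'a::field_char_0"
  assumes "algebraic_int x"
  shows "algebraic_int (poly (map_poly of_int f) x)"
proof -
  obtain p where p: "poly (map_poly of_int p) x = 0" "lead_coeff p = 1"
    using assms by (auto simp: algebraic_int_altdef_ipoly)
  define d where "d = degree p"
  have "d \<noteq> 0"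
  proof
    assume "d = 0"
    then have "p = [:1:]" using p(2) unfolding d_def by (metis degree_0_id)
    then show False using p(1) by simp
  qed
  \<comment> \<open>As \<open>p\<close> is monic, pseudo-division by it is ordinary division with
    remainder over the integers, and the multiple of \<open>p\<close> vanishes at
    \<open>x\<close>.\<close>
  have "\<exists>r. (r = 0 \<or> degree r < d) \<and> poly (map_poly of_int r) x = poly (map_poly of_int g) x" for g :: "int poly"
  proof -
    obtain q r where qr: "pseudo_divmod g p = (q, r)" by force
    have "p \<noteq> 0" using p(2) by auto
    note * = pseudo_divmod[OF this qr]
    have "g = p * q + r" using *(1) p(2) by simp
    then have "poly (map_poly of_int g) x = poly (map_poly of_int r) x"
      using p(1) by (simp add: of_int_poly_hom.hom_add of_int_poly_hom.hom_mult)
    then show ?thesis using *(2) d_def by metis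
  qed
  then obtain r where r: "\<And>g. r g = 0 \<or> degree (r g) < d"
    "\<And>g. poly (map_poly of_int (r g)) x = poly (map_poly of_int g) x" by metis
  \<comment> \<open>Multiplication by \<open>f(x)\<close> on the span of \<open>1, x, \<dots>, x\<^sup>d\<^sup>-\<^sup>1\<close> has an integer matrix.\<close>
  define A where "A = mat d d (\<lambda>(i, j). coeff (r (f * monom 1 i)) j)"
  define v where "v = vec d (\<lambda>i. x ^ i)"
  define y where "y = poly (map_poly of_int f) x"
  let ?A = "map_mat of_int A :: 'a mat"
  have A: "A \<in> carrier_mat d d" by (simp add: A_def)
  have "eigenvector ?A v y"
    unfolding eigenvector_def
  proof (intro conjI)
    show "v \<in> carrier_vec (dim_row ?A)" by (simp add: v_def A_def)
    \<comment> \<open>The entry \<open>x ^ 0\<close> keeps \<open>v\<close> nonzero even for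
      \<open>x = 0\<close>; it exists because \<open>d\<close> is positive.\<close>
    have "v $ 0 = 1" using \<open>d \<noteq> 0\<close> by (simp add: v_def)
    then show "v \<noteq> 0\<^sub>v (dim_row ?A)" using \<open>d \<noteq> 0\<close> by (auto simp: A_def)
    show "?A *\<^sub>v v = y \<cdot>\<^sub>v v"
    proof (rule eq_vecI)
      fix i assume "i < dim_vec (y \<cdot>\<^sub>v v)"
      then have i: "i < d" by (simp add: v_def)
      let ?r = "map_poly of_int (r (f * monom 1 i)) :: 'a poly"
      have "(?A *\<^sub>v v) $ i = (\<Sum>j<d. coeff ?r j * x ^ j)"
        using i by (simp add: A_def v_def scalar_prod_def atLeast0LessThan)
      also have "\<dots> = poly ?r x"
        unfolding poly_altdef
        using r(1)[of "f * monom 1 i"] \<open>d \<noteq> 0\<close> by (intro sum.mono_neutral_right) (auto simp: coeff_eq_0)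
      also have "\<dots> = y * x ^ i"
        by (simp add: r(2) y_def of_int_poly_hom.hom_mult poly_monom map_poly_monom)
      finally show "(?A *\<^sub>v v) $ i = (y \<cdot>\<^sub>v v) $ i" using i by (simp add: v_def)
    qed (simp add: A_def v_def)
  qed
  then have "poly (char_poly ?A) y = 0"
    using eigenvalue_root_char_poly[of ?A d y] A by (auto simp: eigenvalue_def)
  then have "poly (map_poly of_int (char_poly A)) y = 0"
    by (simp add: of_int_hom.char_poly_hom[OF A])
  then show ?thesis
    using degree_monic_char_poly[OF A] unfolding algebraic_int_altdef_ipoly y_def by auto
qed

section \<open>Number fields and their rings of integers\<close>

lemma subfield_setD:
  assumes "subfield_set K"
  shows "0 \<in> K" "1 \<in> K" "x \<in> K \<Longrightarrow> y \<in> K \<Longrightarrow> x + y \<in> K" "x \<in> K \<Longrightarrow> y \<in> K \<Longrightarrow> x * y \<in> K"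
    "x \<in> K \<Longrightarrow> - x \<in> K" "x \<in> K \<Longrightarrow> y \<in> K \<Longrightarrow> x - y \<in> K" "x \<in> K \<Longrightarrow> y \<in> K \<Longrightarrow> x / y \<in> K"
proof -
  note * = assms[unfolded subfield_set_def]
  show "0 \<in> K" "1 \<in> K" "x \<in> K \<Longrightarrow> y \<in> K \<Longrightarrow> x + y \<in> K" "x \<in> K \<Longrightarrow> y \<in> K \<Longrightarrow> x * y \<in> K"
    "x \<in> K \<Longrightarrow> - x \<in> K"
    using * by auto
  show "x \<in> K \<Longrightarrow> y \<in> K \<Longrightarrow> x - y \<in> K"
    using * by (metis diff_conv_add_uminus)
  show "x \<in> K \<Longrightarrow> y \<in> K \<Longrightarrow> x / y \<in> K"
    using * by (metis divide_inverse)
qed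

lemma subfield_set_sum:
  assumes "subfield_set K" "\<And>i. i \<in> A \<Longrightarrow> f i \<in> K"
  shows "sum f A \<in> K"
  using assms(2) by (induction A rule: infinite_finite_induct) (auto simp: subfield_setD[OF assms(1)])

lemma int_span_powers_eq_poly:
  fixes \<gamma> :: "'a::field_char_0"
  assumes "x \<in> int_mod.span ((\<lambda>i. \<gamma> ^ i) ` N)"
  shows "\<exists>f. x = poly (map_poly of_int f) \<gamma>"
  using assms
proof (induction rule: int_mod.span_induct_alt)
  case base
  show ?case by (rule exI[of _ 0]) simp
next
  case (step c y z)
  then obtain i f where "y = \<gamma> ^ i" "z = poly (map_poly of_int f) \<gamma>" by auto
  then show ?case
    by (intro exI[of _ "monom c i + f"])
       (simp add: of_int_poly_hom.hom_add map_poly_monom poly_monom)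
qed

text \<open>Clearing denominators: multiplying a rational relation by the product \<open>D\<close>
  of all denominators gives an integral one, still nontrivial.\<close>

lemma rat_independent_if_int_independent:
  fixes B :: "'a::field_char_0 set"
  assumes "int_mod.independent B" "finite B"
  shows "rat_vs.independent B"
proof
  assume "rat_vs.dependent B"
  then obtain u v where u: "v \<in> B" "u v \<noteq> 0" "(\<Sum>v\<in>B. of_rat (u v) * v) = 0"
    using assms(2) by (auto simp: rat_vs.dependent_finite)
  define D where "D = (\<Prod>v\<in>B. snd (quotient_of (u v)))"
  have "D \<noteq> 0"
    using assms(2) by (simp add: D_def quotient_of_nonzero)
  have "\<exists>w. of_int w = of_int D * u x" if "x \<in> B" for x
  proof -
    obtain a b where ab: "quotient_of (u x) = (a, b)" by force
    have "D = b * (\<Prod>v\<in>B - {x}. snd (quotient_of (u v)))"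
      unfolding D_def using that assms(2) ab by (simp add: prod.remove[of B x])
    moreover have "u x = of_int a / of_int b" "b \<noteq> 0"
      using quotient_of_div[OF ab] quotient_of_denom_pos[OF ab] by auto
    ultimately show ?thesis
      by (intro exI[of _ "a * (\<Prod>v\<in>B - {x}. snd (quotient_of (u v)))"]) simp
  qed
  then obtain w where w: "\<And>x. x \<in> B \<Longrightarrow> of_int (w x) = of_int D * u x" by metis
  have "(\<Sum>x\<in>B. of_int (w x) * x) = of_int D * (\<Sum>x\<in>B. of_rat (u x) * x)"
    unfolding sum_distrib_left
  proof (intro sum.cong refl)
    fix x assume "x \<in> B"
    have "(of_int (w x) :: 'a) = of_rat (of_int (w x))" by simp
    also have "\<dots> = of_int D * of_rat (u x)"
      unfolding w[OF \<open>x \<in> B\<close>] by (simp add: of_rat_mult)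
    finally show "of_int (w x) * x = of_int D * (of_rat (u x) * x)" by simp
  qed
  then have "(\<Sum>x\<in>B. of_int (w x) * x) = 0" using u(3) by simp
  moreover have "w v \<noteq> 0" using w[OF u(1)] u(2) \<open>D \<noteq> 0\<close> by auto
  ultimately have "int_mod.dependent B"
    using u(1) assms(2) by (auto simp: int_mod.dependent_finite)
  then show False using assms(1) by simp
qed

text \<open>A vector of \<open>K\<close> outside the span would enlarge \<open>B\<close> to an
  independent set with more elements than a basis \<open>C\<close> of \<open>K\<close>. The
  finiteness of \<open>B\<close> comes out of the same exchange bound.\<close>

lemma rat_span_eq_number_field:
  fixes K :: "'a::field_char_0 set"
  assumes "number_field K" "rat_vs.independent B" "B \<subseteq> K" "card B = field_degree K"
  shows "rat_vs.span B = K"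
proof -
  obtain T where T: "finite T" "rat_vs.span T = K"
    using assms(1) unfolding number_field_def by auto
  obtain C where C: "C \<subseteq> K" "rat_vs.independent C" "K \<subseteq> rat_vs.span C" "card C = rat_vs.dim K"
    by (rule rat_vs.basis_exists)
  have "finite C" using rat_vs.independent_span_bound[OF T(1) C(2)] C(1) T(2) by auto
  have "v \<in> rat_vs.span B" if "v \<in> K" for v
  proof (rule ccontr)
    assume v: "v \<notin> rat_vs.span B"
    then have "rat_vs.independent (insert v B)" using assms(2) rat_vs.independent_insertI by blast
    from rat_vs.independent_span_bound[OF \<open>finite C\<close> this]
    have "finite (insert v B)" "card (insert v B) \<le> card C" using assms(3) that C(3) by auto
    moreover have "v \<notin> B" using v rat_vs.span_base by blast
    ultimately show False using assms(4) C(4) by (simp add: field_degree_def)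
  qed
  moreover have "rat_vs.span B \<subseteq> K"
    using assms(3) T(2) rat_vs.span_minimal rat_vs.subspace_span by metis
  ultimately show ?thesis by auto
qed

text \<open>Sums are handled by the integral span, products by writing both factors as integer
  polynomials in \<open>\<gamma>\<close>.\<close>

lemma ring_of_integers_closed:
  fixes K :: "'a::field_char_0 set"
  assumes "number_field K" "has_power_integral_basis K"
  shows "0 \<in> ring_of_integers K" "1 \<in> ring_of_integers K"
    "x \<in> ring_of_integers K \<Longrightarrow> y \<in> ring_of_integers K \<Longrightarrow> x + y \<in> ring_of_integers K"
    "x \<in> ring_of_integers K \<Longrightarrow> y \<in> ring_of_integers K \<Longrightarrow> x * y \<in> ring_of_integers K"
proof -
  have K: "subfield_set K" using assms(1) by (simp add: number_field_def)
  obtain \<gamma> where \<gamma>: "\<gamma> \<in> ring_of_integers K"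
    "int_mod.span ((\<lambda>i. \<gamma> ^ i) ` {..<field_degree K}) = ring_of_integers K"
    using assms(2) unfolding has_power_integral_basis_def by blast
  show "0 \<in> ring_of_integers K" "1 \<in> ring_of_integers K"
    by (simp_all add: ring_of_integers_def subfield_setD[OF K])
  show "x \<in> ring_of_integers K \<Longrightarrow> y \<in> ring_of_integers K \<Longrightarrow> x + y \<in> ring_of_integers K"
    unfolding \<gamma>(2)[symmetric] by (rule int_mod.span_add)
  show "x * y \<in> ring_of_integers K" if xy: "x \<in> ring_of_integers K" "y \<in> ring_of_integers K"
  proof -
    obtain f g where "x = poly (map_poly of_int f) \<gamma>" "y = poly (map_poly of_int g) \<gamma>"
      using xy[folded \<gamma>(2), THEN int_span_powers_eq_poly] by auto
    then have "x * y = poly (map_poly of_int (f * g)) \<gamma>" by (simp add: of_int_poly_hom.hom_mult)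
    then have "algebraic_int (x * y)"
      using algebraic_int_of_int_poly \<gamma>(1) by (auto simp: ring_of_integers_def)
    then show ?thesis using that by (simp add: ring_of_integers_def subfield_setD[OF K])
  qed
qed

section \<open>Self-duality of the ring of integers\<close>

text \<open>For the last property it suffices to test with \<open>x = \<gamma> ^ j\<close>. The
  integers \<open>l (\<gamma> ^ (i + j))\<close> are 0 for \<open>i + j < n - 1\<close> and 1 for
  \<open>i + j = n - 1\<close>, so this is a triangular system with unit diagonal for the
  coefficients of \<open>\<theta>\<close>, solved over the integers from the highest coefficient
  down.\<close>

lemma power_basis_dual_functional:
  fixes K :: "'a::field_char_0 set"
  assumes "number_field K" "has_power_integral_basis K"
  obtains l :: "'a \<Rightarrow> rat"
  where "\<And>x y. x \<in> K \<Longrightarrow> y \<in> K \<Longrightarrow> l (x + y) = l x + l y"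
    and "\<And>x. x \<in> ring_of_integers K \<Longrightarrow> l x \<in> \<int>"
    and "\<And>\<theta>. \<theta> \<in> K \<Longrightarrow> (\<And>x. x \<in> ring_of_integers K \<Longrightarrow> l (x * \<theta>) \<in> \<int>) \<Longrightarrow> \<theta> \<in> ring_of_integers K"
proof -
  have K: "subfield_set K" using assms(1) by (simp add: number_field_def)
  note ring = ring_of_integers_closed[OF assms]
  define n where "n = field_degree K"
  obtain \<gamma> where \<gamma>: "\<gamma> \<in> ring_of_integers K" "inj_on (\<lambda>i. \<gamma> ^ i) {..<n}"
    "int_mod.independent ((\<lambda>i. \<gamma> ^ i) ` {..<n})"
    "int_mod.span ((\<lambda>i. \<gamma> ^ i) ` {..<n}) = ring_of_integers K"
    using assms(2) unfolding has_power_integral_basis_def n_def by blast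
  define B where "B = (\<lambda>i. \<gamma> ^ i) ` {..<n}"
  have pow: "\<gamma> ^ i \<in> ring_of_integers K" for i
    by (induction i) (auto intro: ring \<gamma>(1))
  have OK: "ring_of_integers K \<subseteq> K" by (auto simp: ring_of_integers_def)
  have ind: "rat_vs.independent B"
    using rat_independent_if_int_independent[OF \<gamma>(3)] by (simp add: B_def)
  have span: "rat_vs.span B = K"
    using assms(1) ind
  proof (rule rat_span_eq_number_field)
    show "B \<subseteq> K" using pow OK by (auto simp: B_def)
    show "card B = field_degree K" using \<gamma>(2) by (simp add: B_def card_image n_def)
  qed
  \<comment> \<open>This ensures that \<open>n - 1\<close> is a genuine exponent of the
    basis.\<close>
  have "n > 0"
  proof (rule ccontr)
    assume "\<not> n > 0"
    then have "ring_of_integers K = {0}" using \<gamma>(4) by simp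
    then show False using ring(2) by simp
  qed
  define l where "l x = rat_vs.representation B x (\<gamma> ^ (n - 1))" for x
  have add: "l (x + y) = l x + l y" if "x \<in> K" "y \<in> K" for x y
    using that span by (simp add: l_def rat_vs.representation_add[OF ind])
  have scale: "l (of_rat c * x) = c * l x" if "x \<in> K" for c x
    using that span by (simp add: l_def rat_vs.representation_scale[OF ind])
  have zero: "l 0 = 0" by (simp add: l_def rat_vs.representation_zero)
  have l_pow: "l (\<gamma> ^ i) = (if i = n - 1 then 1 else 0)" if "i < n" for i
  proof -
    have "\<gamma> ^ i = \<gamma> ^ (n - 1) \<longleftrightarrow> i = n - 1"
      using inj_onD[OF \<gamma>(2), of i "n - 1"] that \<open>n > 0\<close> by auto
    then show ?thesis
      using rat_vs.representation_basis[OF ind, of "\<gamma> ^ i"] that by (auto simp: l_def B_def)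
  qed
  have l_int: "l x \<in> \<int>" if "x \<in> ring_of_integers K" for x
  proof -
    have "x \<in> int_mod.span B" using that \<gamma>(4) by (simp add: B_def)
    then have "x \<in> K \<and> l x \<in> \<int>"
    proof (induction rule: int_mod.span_induct_alt)
      case base
      show ?case by (simp add: zero subfield_setD[OF K])
    next
      case (step c y z)
      have y: "y \<in> K" "l y \<in> \<int>" using step pow OK by (auto simp: B_def l_pow)
      have "of_int c * y = of_rat (of_int c) * y" by simp
      then have *: "of_int c * y \<in> K" "l (of_int c * y) = of_int c * l y"
        using scale[OF y(1), of "of_int c"] y(1) rat_vs.span_scale[of y B "of_int c"] span by auto
      then show ?case using y step by (simp add: add subfield_setD[OF K])
    qed
    then show ?thesis by simp
  qed
  have "\<theta> \<in> ring_of_integers K"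
    if \<theta>: "\<theta> \<in> K" "\<And>x. x \<in> ring_of_integers K \<Longrightarrow> l (x * \<theta>) \<in> \<int>" for \<theta>
  proof -
    have "\<theta> \<in> rat_vs.span B" using \<theta>(1) span by simp
    then obtain u where "\<theta> = (\<Sum>v\<in>B. of_rat (u v) * v)"
      by (subst (asm) rat_vs.span_finite) (auto simp: B_def)
    then have \<theta>_eq: "\<theta> = (\<Sum>i<n. of_rat (u (\<gamma> ^ i)) * \<gamma> ^ i)"
      by (simp add: B_def sum.reindex[OF \<gamma>(2)])
    define c where "c i = u (\<gamma> ^ i)" for i
    have in_K: "of_rat q * \<gamma> ^ i \<in> K" for q i
      using pow[of i] OK span by (metis rat_vs.span_scale subsetD)
    have l_sum: "l (\<Sum>i\<in>A. of_rat (c i) * \<gamma> ^ (j + i)) = (\<Sum>i\<in>A. c i * l (\<gamma> ^ (j + i)))"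
      if "finite A" for A j
      using that
    proof (induction A rule: finite_induct)
      case (insert a A)
      have "(\<Sum>i\<in>A. of_rat (c i) * \<gamma> ^ (j + i)) \<in> K"
        by (intro subfield_set_sum K in_K)
      then show ?case using insert in_K pow OK by (simp add: add scale subsetD)
    qed (simp add: zero)
    \<comment> \<open>Multiplying by \<open>\<gamma>\<^sup>j\<close> moves the coefficient of \<open>\<gamma>\<^sup>n\<^sup>-\<^sup>1\<^sup>-\<^sup>j\<close> to the top.\<close>
    have c_int: "c (n - 1 - j) \<in> \<int>" if "j < n" for j
      using that
    proof (induction j rule: less_induct)
      case (less j)
      have "\<gamma> ^ j * \<theta> = (\<Sum>i<n. of_rat (c i) * \<gamma> ^ (j + i))"
        unfolding \<theta>_eq sum_distrib_left by (simp add: c_def power_add algebra_simps)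
      then have "l (\<gamma> ^ j * \<theta>) = (\<Sum>i<n. c i * l (\<gamma> ^ (j + i)))"
        by (simp add: l_sum)
      also have "\<dots> = c (n - 1 - j) + (\<Sum>i\<in>{..<n} - {n - 1 - j}. c i * l (\<gamma> ^ (j + i)))"
        using less.prems by (subst sum.remove[of _ "n - 1 - j"]) (auto simp: l_pow)
      finally have "c (n - 1 - j) =
          l (\<gamma> ^ j * \<theta>) - (\<Sum>i\<in>{..<n} - {n - 1 - j}. c i * l (\<gamma> ^ (j + i)))"
        by simp
      \<comment> \<open>Below the index \<open>n - 1 - j\<close> the value of \<open>l\<close> is 0;
        above it, \<open>c i\<close> was already shown integral, at the smaller index
        \<open>n - 1 - i\<close>.\<close>
      moreover have "c i * l (\<gamma> ^ (j + i)) \<in> \<int>" if "i \<in> {..<n} - {n - 1 - j}" for i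
      proof (cases "i < n - 1 - j")
        case True
        then have "j + i < n" "j + i \<noteq> n - 1" by auto
        then show ?thesis by (simp add: l_pow)
      next
        case False
        then have "i = n - 1 - (n - 1 - i)" "n - 1 - i < j" "n - 1 - i < n"
          using that less.prems by auto
        then have "c i \<in> \<int>" using less.IH by metis
        then show ?thesis using l_int[OF pow] by simp
      qed
      ultimately show ?case using \<theta>(2)[OF pow[of j]] by (auto intro!: Ints_diff Ints_sum)
    qed
    have "of_rat (c i) * \<gamma> ^ i \<in> ring_of_integers K" if "i < n" for i
    proof -
      have "c i \<in> \<int>" using c_int[of "n - 1 - i"] that by simp
      then obtain z where "c i = of_int z" by (auto elim: Ints_cases)
      then show ?thesis using pow[of i] int_mod.span_scale \<gamma>(4) by (metis of_rat_of_int_eq)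
    qed
    then have "(\<Sum>i<n. of_rat (c i) * \<gamma> ^ i) \<in> ring_of_integers K"
      unfolding \<gamma>(4)[symmetric] by (intro int_mod.span_sum) auto
    then show ?thesis by (simp add: \<theta>_eq c_def)
  qed
  then show thesis using that add l_int by blast
qed

text \<open>The map sending \<open>q\<close> to \<open>cis (2 * pi * q)\<close> turns sums into
  products and takes the value 1 exactly at the integers, so each property of \<open>l\<close>
  carries over.\<close>

lemma power_basis_dual_character:
  fixes K :: "'a::field_char_0 set"
  assumes "number_field K" "has_power_integral_basis K"
  obtains \<psi> :: "'a \<Rightarrow> complex"
  where "\<And>x y. x \<in> K \<Longrightarrow> y \<in> K \<Longrightarrow> \<psi> (x + y) = \<psi> x * \<psi> y"
    and "\<And>x. x \<in> ring_of_integers K \<Longrightarrow> \<psi> x = 1"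
    and "\<And>\<theta>. \<theta> \<in> K \<Longrightarrow> (\<And>x. x \<in> ring_of_integers K \<Longrightarrow> \<psi> (x * \<theta>) = 1) \<Longrightarrow> \<theta> \<in> ring_of_integers K"
proof -
  obtain l :: "'a \<Rightarrow> rat" where l: "\<And>x y. x \<in> K \<Longrightarrow> y \<in> K \<Longrightarrow> l (x + y) = l x + l y"
    "\<And>x. x \<in> ring_of_integers K \<Longrightarrow> l x \<in> \<int>"
    "\<And>\<theta>. \<theta> \<in> K \<Longrightarrow> (\<And>x. x \<in> ring_of_integers K \<Longrightarrow> l (x * \<theta>) \<in> \<int>) \<Longrightarrow> \<theta> \<in> ring_of_integers K"
    using power_basis_dual_functional[OF assms] by blast
  define \<psi> where "\<psi> x = cis (2 * pi * of_rat (l x))" for x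
  have \<psi>_1: "\<psi> x = 1 \<longleftrightarrow> l x \<in> \<int>" for x
  proof
    assume "\<psi> x = 1"
    then obtain z where "real_of_rat (l x) = real_of_int z"
      by (auto simp: \<psi>_def cis_eq_1_iff)
    then have "l x = of_int z" by (metis of_rat_eq_iff of_rat_of_int_eq)
    then show "l x \<in> \<int>" by simp
  next
    assume "l x \<in> \<int>"
    then show "\<psi> x = 1" by (auto simp: \<psi>_def elim!: Ints_cases)
  qed
  show thesis
  proof (rule that[of \<psi>])
    show "\<psi> (x + y) = \<psi> x * \<psi> y" if "x \<in> K" "y \<in> K" for x y
      using l(1)[OF that] by (simp add: \<psi>_def cis_mult of_rat_add distrib_left)
  qed (use \<psi>_1 l in auto)
qed

section \<open>From covers to vanishing sums over subsets\<close>

text \<open>Adding or removing \<open>s\<close> respects \<open>U \<subseteq> I\<close>, because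
  \<open>s\<close> is not in \<open>U\<close>, and flips the sign of \<open>prod g I\<close>. This
  is the zero factor \<open>1 + g s\<close> of the expanded product.\<close>

lemma sum_supersets_prod_eq_0:
  fixes g :: "'b \<Rightarrow> 'f::comm_ring_1"
  assumes "finite S" "s \<in> S" "s \<notin> U" "g s = - 1"
  shows "(\<Sum>I | I \<subseteq> S \<and> U \<subseteq> I. prod g I) = 0"
proof -
  define S' where "S' = S - {s}"
  have S: "S = insert s S'" "finite S'" "s \<notin> S'" using assms by (auto simp: S'_def)
  have "prod g (insert s I) = - prod g I" if "I \<subseteq> S'" for I
    using that S assms(4) finite_subset by (subst prod.insert) auto
  moreover have "{I. I \<subseteq> S' \<and> U \<subseteq> insert s I} = {I. I \<subseteq> S' \<and> U \<subseteq> I}"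
    using assms(3) by auto
  ultimately show ?thesis
    unfolding S(1) by (simp only: sum_Pow_insert[OF S(2,3)]) (simp add: sum_negf)
qed

theorem theorem1p2:
  fixes K :: "'a::field_char_0 set"
    and m k :: nat
    and \<alpha> \<beta> \<omega> :: "nat \<Rightarrow> 'a"
    and \<mu> :: 'a
  assumes "number_field K"
    and "has_power_integral_basis K"
    and "m > 0"
    and "\<And>s. s \<in> {1..k} \<Longrightarrow> \<alpha> s \<in> ring_of_integers K"
    and "\<And>s. s \<in> {1..k} \<Longrightarrow> \<beta> s \<in> ring_of_integers K"
    and "\<And>s. s \<in> {1..k} \<Longrightarrow> \<beta> s \<noteq> 0"
    and "is_m_cover K m k \<alpha> \<beta>"
    and "\<And>s. s \<in> {1..k} \<Longrightarrow> \<omega> s \<in> ring_of_integers K"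
    and "\<mu> \<in> K"
  shows "{I. I \<subseteq> {1..k} \<and> (\<Sum>s\<in>I. \<omega> s / \<beta> s) \<in> (+) \<mu> ` ring_of_integers K} = {} \<or>
         card {I. I \<subseteq> {1..k} \<and> (\<Sum>s\<in>I. \<omega> s / \<beta> s) \<in> (+) \<mu> ` ring_of_integers K} \<ge> 2 ^ m"
proof -
  have K: "subfield_set K" using assms(1) by (simp add: number_field_def)
  note ring = ring_of_integers_closed[OF assms(1,2)] and field = subfield_setD[OF K]
  have OK: "x \<in> K" if "x \<in> ring_of_integers K" for x
    using that by (simp add: ring_of_integers_def)
  obtain \<psi> :: "'a \<Rightarrow> complex" where
    \<psi>_add: "\<And>x y. x \<in> K \<Longrightarrow> y \<in> K \<Longrightarrow> \<psi> (x + y) = \<psi> x * \<psi> y" and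
    \<psi>_int: "\<And>x. x \<in> ring_of_integers K \<Longrightarrow> \<psi> x = 1" and
    \<psi>_dual: "\<And>\<theta>. \<theta> \<in> K \<Longrightarrow> (\<And>x. x \<in> ring_of_integers K \<Longrightarrow> \<psi> (x * \<theta>) = 1) \<Longrightarrow> \<theta> \<in> ring_of_integers K"
    using power_basis_dual_character[OF assms(1,2)] by blast
  have \<psi>_0: "\<psi> 0 = 1" using \<psi>_int ring by simp
  have \<psi>_nz: "\<psi> x \<noteq> 0" if "x \<in> K" for x
    using \<psi>_add[of x "- x"] that field \<psi>_0 by auto
  have \<psi>_sum: "\<psi> (sum f I) = (\<Prod>s\<in>I. \<psi> (f s))" if "\<And>s. s \<in> I \<Longrightarrow> f s \<in> K" for f :: "nat \<Rightarrow> 'a" and I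
    using that
    by (induction I rule: infinite_finite_induct) (auto simp: \<psi>_0 \<psi>_add subfield_set_sum[OF K])
  define S where "S = {1..k}"
  define \<sigma> where "\<sigma> I = (\<Sum>s\<in>I. \<omega> s / \<beta> s)" for I
  define C where "C = {I. I \<subseteq> S \<and> \<sigma> I \<in> (+) \<mu> ` ring_of_integers K}"
  \<comment> \<open>The part of the expanded product free of \<open>x\<close>:
    \<open>a I * \<psi> (x * \<sigma> I)\<close> is the product over \<open>I\<close> of the terms
    \<open>- \<psi> ((x - \<alpha> s) * (\<omega> s / \<beta> s))\<close>. It never vanishes, so
    cutting it off outside \<open>C\<close> gives a function \<open>F\<close> with support exactly
    \<open>C\<close>.\<close>
  define a where "a I = (\<Prod>s\<in>I. - \<psi> (- \<alpha> s * (\<omega> s / \<beta> s)))" for I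
  define F where "F I = (if I \<in> C then a I else 0)" for I
  have \<omega>\<beta>: "\<omega> s / \<beta> s \<in> K" if "s \<in> S" for s
    using that assms(5,8) by (intro field OK) (auto simp: S_def)
  have \<alpha>: "\<alpha> s \<in> K" if "s \<in> S" for s
    using that assms(4) by (intro OK) (auto simp: S_def)
  have \<sigma>: "\<sigma> I \<in> K" if "I \<subseteq> S" for I
    unfolding \<sigma>_def using that by (intro subfield_set_sum[OF K] \<omega>\<beta>) auto
  have a_nz: "a I \<noteq> 0" if "I \<subseteq> S" for I
  proof -
    have "finite I" using that finite_subset by (auto simp: S_def)
    moreover have "\<psi> (- \<alpha> s * (\<omega> s / \<beta> s)) \<noteq> 0" if "s \<in> I" for s
      using that \<open>I \<subseteq> S\<close> by (intro \<psi>_nz field(4,5) \<alpha> \<omega>\<beta>) auto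
    ultimately show ?thesis by (simp add: a_def)
  qed
  \<comment> \<open>Duality applied to \<open>\<sigma> I - \<mu>\<close>: the sets in
    \<open>C\<close> are those whose character on the ring of integers equals that of
    \<open>\<mu>\<close>.\<close>
  have C_iff: "I \<in> C \<longleftrightarrow> (\<forall>x\<in>ring_of_integers K. \<psi> (x * \<sigma> I) = \<psi> (x * \<mu>))" if "I \<subseteq> S" for I
  proof -
    have *: "\<psi> (x * \<sigma> I) = \<psi> (x * \<mu>) * \<psi> (x * (\<sigma> I - \<mu>))" if "x \<in> ring_of_integers K" for x
      using \<psi>_add[of "x * \<mu>" "x * (\<sigma> I - \<mu>)"] OK[OF that] \<sigma>[OF \<open>I \<subseteq> S\<close>] assms(9) field
      by (simp add: algebra_simps)
    have "I \<in> C \<longleftrightarrow> \<sigma> I - \<mu> \<in> ring_of_integers K"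
    proof
      assume "\<sigma> I - \<mu> \<in> ring_of_integers K"
      then have "\<mu> + (\<sigma> I - \<mu>) \<in> (+) \<mu> ` ring_of_integers K" by (rule imageI)
      then show "I \<in> C" using that by (simp add: C_def)
    qed (auto simp: C_def)
    also have "\<dots> \<longleftrightarrow> (\<forall>x\<in>ring_of_integers K. \<psi> (x * (\<sigma> I - \<mu>)) = 1)"
      using \<psi>_int ring(4) \<psi>_dual[OF field(6)[OF \<sigma>[OF that] assms(9)]] by auto
    also have "\<dots> \<longleftrightarrow> (\<forall>x\<in>ring_of_integers K. \<psi> (x * \<sigma> I) = \<psi> (x * \<mu>))"
      using * \<psi>_nz[OF field(4)[OF OK assms(9)]] by simp
    finally show ?thesis .
  qed
  have vanish: "(\<Sum>I | I \<subseteq> S \<and> U \<subseteq> I. F I) = 0" if U: "U \<subseteq> S" "card U < m" for U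
  proof -
    let ?A = "{I. I \<subseteq> S \<and> U \<subseteq> I}"
    have fin: "finite S" "finite ?A" by (auto simp: S_def)
    have zero: "(\<Sum>I\<in>?A. a I * \<psi> (x * \<sigma> I)) = 0" if x: "x \<in> ring_of_integers K" for x
    proof -
      let ?g = "\<lambda>s. - \<psi> ((x - \<alpha> s) * (\<omega> s / \<beta> s))"
      let ?T = "{s \<in> S. x \<in> residue_coset K (\<alpha> s) (\<beta> s)}"
      \<comment> \<open>At least \<open>m\<close> cosets contain \<open>x\<close> and
        \<open>U\<close> has fewer than \<open>m\<close> indices, so some coset containing
        \<open>x\<close> has its index \<open>s\<close> outside \<open>U\<close>.\<close>
      have "card U < card ?T" using U(2) assms(7) x by (auto simp: is_m_cover_def S_def dest: bspec)
      then have "\<not> ?T \<subseteq> U" using card_mono[of U ?T] finite_subset[OF U(1) fin(1)] by auto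
      then obtain s where s: "s \<in> S" "s \<notin> U" "x \<in> residue_coset K (\<alpha> s) (\<beta> s)" by auto
      then obtain w where w: "w \<in> ring_of_integers K" "x = \<alpha> s + \<beta> s * w"
        by (auto simp: residue_coset_def)
      \<comment> \<open>On the coset the denominator cancels, so the argument of
        \<open>\<psi>\<close> is an algebraic integer of \<open>K\<close>, where
        \<open>\<psi>\<close> is 1.\<close>
      have "(x - \<alpha> s) * (\<omega> s / \<beta> s) = w * \<omega> s"
        using w(2) assms(6) s(1) by (simp add: S_def)
      then have "?g s = - 1"
        using \<psi>_int ring w(1) assms(8) s(1) by (simp add: S_def)
      then have "(\<Sum>I\<in>?A. prod ?g I) = 0"
        by (intro sum_supersets_prod_eq_0[OF fin(1) s(1,2)])
      moreover have "a I * \<psi> (x * \<sigma> I) = prod ?g I" if "I \<in> ?A" for I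
      proof -
        have "\<psi> (x * \<sigma> I) = (\<Prod>s\<in>I. \<psi> (x * (\<omega> s / \<beta> s)))"
          unfolding \<sigma>_def sum_distrib_left using that
          by (intro \<psi>_sum field(4) \<omega>\<beta> OK[OF x]) auto
        moreover have "\<psi> ((x - \<alpha> s) * (\<omega> s / \<beta> s)) =
            \<psi> (- \<alpha> s * (\<omega> s / \<beta> s)) * \<psi> (x * (\<omega> s / \<beta> s))" if "s \<in> S" for s
        proof -
          have "(x - b) * q = - b * q + x * q" for b q by (simp add: algebra_simps)
          then show ?thesis
            using \<psi>_add[OF field(4)[OF field(5)[OF \<alpha>[OF that]] \<omega>\<beta>[OF that]] field(4)[OF OK[OF x] \<omega>\<beta>[OF that]]]
            by presburger
        qed
        ultimately show ?thesis
          using that unfolding a_def by (auto simp only: prod.distrib[symmetric] mult_minus_left intro!: prod.cong)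
      qed
      ultimately show ?thesis by simp
    qed
    \<comment> \<open>The relation \<open>zero\<close> holds for all \<open>x\<close> in the ring of
      integers, so independence of characters extracts the coefficients belonging to the character
      of \<open>\<mu>\<close>.\<close>
    have "sum a (?A \<inter> C) = 0"
    proof (rule sum_coeffs_same_character_eq_0[where D = "?A - C" and G = "ring_of_integers K"
          and \<chi> = "\<lambda>I x. \<psi> (x * \<sigma> I)" and \<phi> = "\<lambda>x. \<psi> (x * \<mu>)"])
      have *: "?A \<inter> C \<union> (?A - C) = ?A" by auto
      show "(\<Sum>I\<in>?A \<inter> C \<union> (?A - C). a I * \<psi> (x * \<sigma> I)) = 0" if "x \<in> ring_of_integers K" for x
        unfolding * using zero[OF that] .
      show "\<psi> ((x + y) * \<sigma> I) = \<psi> (x * \<sigma> I) * \<psi> (y * \<sigma> I)"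
        if "I \<in> ?A \<inter> C \<union> (?A - C)" "x \<in> ring_of_integers K" "y \<in> ring_of_integers K" for I x y
      proof -
        have "I \<subseteq> S" using that(1) by auto
        then show ?thesis
          unfolding distrib_right using that(2,3) by (intro \<psi>_add field(4) OK \<sigma>)
      qed
      show "\<psi> (x * \<sigma> I) = \<psi> (x * \<mu>)" if "I \<in> ?A \<inter> C" "x \<in> ring_of_integers K" for I x
        using that C_iff[of I] by blast
      show "\<exists>x\<in>ring_of_integers K. \<psi> (x * \<sigma> I) \<noteq> \<psi> (x * \<mu>)" if "I \<in> ?A - C" for I
        using that C_iff[of I] by blast
      show "\<psi> (0 * \<mu>) = 1" using \<psi>_0 by simp
    qed (use fin(2) in \<open>auto intro: ring(1,3)\<close>)
    moreover have "sum a (?A \<inter> C) = sum F ?A"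
      using fin(2) by (simp add: F_def sum.inter_restrict)
    ultimately show ?thesis by simp
  qed
  have supp: "{I. I \<subseteq> S \<and> F I \<noteq> 0} = C"
    using a_nz by (auto simp: F_def C_def)
  have "2 ^ m \<le> card C" if "I \<in> C" for I
  proof -
    have "I \<subseteq> S" "F I \<noteq> 0" using that supp by auto
    then show ?thesis
      using card_support[of S m F I] vanish supp by (simp add: S_def)
  qed
  then have "C = {} \<or> 2 ^ m \<le> card C" by auto
  then show ?thesis by (simp only: C_def \<sigma>_def S_def)
qed
end
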